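(* Let $g = -\frac{dT^2}{(V+cT)^2} + (V+cT)^2\,|d\mathbf{x}|^2$ be the Kastor-Traschen metric, where $V=V(\mathbf{x})$ is a harmonic function of the spatial coordinates $\mathbf{x}=(x^1,x^2,x^3)$ and $c$ is a constant. For a constant $\lambda$ consider the equation $$\ddot{\mathbf{x}} = \frac{2}{V+cT}\left(\dot{\mathbf{x}}\times(\nabla V\times\dot{\mathbf{x}})\right)+\lambda\,(\dot{\mathbf{x}}\times\nabla V) \qquad (\ast)$$ for null curves $(T(s),\mathbf{x}(s))$ of $g$. If $c\neq 0$, the retraction projection of the set of null curves satisfying $(\ast)$ for some value of $\lambda$ coincides with the set of integral curves of $$\dddot{\mathbf{x}} = -|\ddot{\mathbf{x}}|^2\dot{\mathbf{x}}-\frac{3}{2}\frac{\ddot{\mathbf{x}}\cdot\nabla V}{|\dot{\mathbf{x}}\times\nabla V|^2}(\dot{\mathbf{x}}\cdot\nabla V)\ddot{\mathbf{x}}-2c\,(\dot{\mathbf{x}}\times(\nabla V\times\dot{\mathbf{x}}))+\frac{\ddot{\mathbf{x}}\cdot\nabla V}{|\dot{\mathbf{x}}\times\nabla V|^2}\left(\dot{\mathbf{x}}\times\left(\frac{d\nabla V}{ds}\times\dot{\mathbf{x}}\right)\right)$$ $$\qquad+\frac{\ddot{\mathbf{x}}\cdot(\dot{\mathbf{x}}\times\nabla V)}{|\dot{\mathbf{x}}\times\nabla V|^2}\left[\left(\frac{\ddot{\mathbf{x}}\cdot\nabla V}{|\dot{\mathbf{x}}\times\nabla V|^2}\right)(\dot{\mathbf{x}}\cdot\nabla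 V)\,\ddot{\mathbf{x}}\times\nabla V+\big((\dot{\mathbf{x}}\times\nabla V)\cdot\ddot{\mathbf{x}}\big)\dot{\mathbf{x}}+\frac{d}{ds}(\dot{\mathbf{x}}\times\nabla V)\right].$$ Furthermore, the projected null geodesics (the retraction projections of null geodesics of $g$) are precisely the integral curves of this system for which $\ddot{\mathbf{x}}\cdot(\dot{\mathbf{x}}\times\nabla V)=0$.
   Context: The Kastor-Traschen metric is a solution of the Einstein-Maxwell equations with positive cosmological constant $\Lambda$, with $c=\pm\sqrt{\Lambda/3}$; $|d\mathbf{x}|^2$ is the flat Euclidean metric on $\mathbb{R}^3$ in Cartesian coordinates. The retraction projection of a curve $(T(s),\mathbf{x}(s))$ is its image in the space of orbits of the vector field $\Theta=\partial/\partial T$ (the timelike conformal retraction), i.e. its spatial part $\mathbf{x}(s)$. Dots denote $d/ds$; dot products, cross products, norms and $\nabla$ are Euclidean on $\mathbb{R}^3$. Curves are parametrised by the Euclidean arc length $s$ of the spatial part, so $|\dot{\mathbf{x}}|=1$, and the null condition is used in the form $\dot T=(V+cT)^2$. Null geodesics of $g$ satisfy $(\ast)$ with $\lambda=0$.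
   Formalization: In the bracket, the factor (ẋ·∇V) ẍ×∇V of the first term is corrected to ½(ẋ·∇V) ẋ×∇V (misprint); null curves with ẋ×∇V=0 somewhere (system undefined) and integral curves with ẍ·∇V=0 somewhere (T infinite) are excluded. *)

theory Defs
  imports "HOL-Analysis.Analysis"
begin

unbundle cross3_syntax

section \<open>Calculus on Euclidean spaces\<close>

definition partial_deriv :: "'n \<Rightarrow> (real^'n \<Rightarrow> real) \<Rightarrow> real^'n \<Rightarrow> real"
  where "partial_deriv i f x = frechet_derivative f (at x) (axis i 1)"

definition grad :: "(real^'n \<Rightarrow> real) \<Rightarrow> real^'n \<Rightarrow> real^'n"
  where "grad f x = (\<chi> i. partial_deriv i f x)"

definition C2_on :: "(real^'n \<Rightarrow> real) \<Rightarrow> (real^'n) set \<Rightarrow> bool"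
  where "C2_on f U \<longleftrightarrow>
    (\<forall>x\<in>U. f differentiable (at x)) \<and>
    (\<forall>i. \<forall>x\<in>U. partial_deriv i f differentiable (at x)) \<and>
    (\<forall>i j. continuous_on U (partial_deriv j (partial_deriv i f)))"

definition harmonic_on :: "(real^'n \<Rightarrow> real) \<Rightarrow> (real^'n) set \<Rightarrow> bool"
  where "harmonic_on f U \<longleftrightarrow>
    C2_on f U \<and> (\<forall>x\<in>U. (\<Sum>i\<in>UNIV. partial_deriv i (partial_deriv i f) x) = 0)"

definition dds :: "(real \<Rightarrow> 'a::real_normed_vector) \<Rightarrow> real \<Rightarrow> 'a"
  where "dds f s = vector_derivative f (at s)"


section \<open>Geodesics of a metric given in coordinates\<close>

definition christoffel :: "(real^'n \<Rightarrow> real^'n^'n) \<Rightarrow> real^'n \<Rightarrow> 'n \<Rightarrow> 'n \<Rightarrow> 'n \<Rightarrow> real"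
  where "christoffel g p \<kappa> \<mu> \<nu> = 1/2 * (\<Sum>\<sigma>\<in>UNIV. matrix_inv (g p) $ \<kappa> $ \<sigma> *
      (partial_deriv \<mu> (\<lambda>q. g q $ \<sigma> $ \<nu>) p
       + partial_deriv \<nu> (\<lambda>q. g q $ \<sigma> $ \<mu>) p
       - partial_deriv \<sigma> (\<lambda>q. g q $ \<mu> $ \<nu>) p))"

definition covariant_acceleration ::
    "(real^'n \<Rightarrow> real^'n^'n) \<Rightarrow> (real \<Rightarrow> real^'n) \<Rightarrow> real \<Rightarrow> real^'n"
  where "covariant_acceleration g \<gamma> s = (\<chi> \<kappa>. dds (dds \<gamma>) s $ \<kappa> +
      (\<Sum>\<mu>\<in>UNIV. \<Sum>\<nu>\<in>UNIV. christoffel g (\<gamma> s) \<kappa> \<mu> \<nu> * dds \<gamma> s $ \<mu> * dds \<gamma> s $ \<nu>))"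

text \<open>The parameter need not be affine, so the covariant acceleration is only required to be
  proportional to the velocity. This matters here: curves are parametrised by the Euclidean arc
  length of their spatial part, which is in general not an affine parameter.\<close>

definition geodesic_on :: "(real^'n \<Rightarrow> real^'n^'n) \<Rightarrow> real set \<Rightarrow> (real \<Rightarrow> real^'n) \<Rightarrow> bool"
  where "geodesic_on g I \<gamma> \<longleftrightarrow>
    (\<forall>s\<in>I. \<gamma> differentiable (at s) \<and> dds \<gamma> differentiable (at s)) \<and>
    (\<exists>f. \<forall>s\<in>I. covariant_acceleration g \<gamma> s = f s *\<^sub>R dds \<gamma> s)"


section \<open>The Kastor-Traschen metric\<close>

text \<open>Coordinates are indexed by \<open>3 option\<close>: the index \<open>None\<close> is \<open>T\<close>, the index
  \<open>Some i\<close> is \<open>x\<^sup>i\<close>.\<close>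

type_synonym event = "real^(3 option)"

definition time_part :: "event \<Rightarrow> real"
  where "time_part p = p $ None"

definition space_part :: "event \<Rightarrow> real^3"
  where "space_part p = (\<chi> i. p $ Some i)"

definition kt_factor :: "(real^3 \<Rightarrow> real) \<Rightarrow> real \<Rightarrow> event \<Rightarrow> real"
  where "kt_factor V c p = V (space_part p) + c * time_part p"

definition kt_metric :: "(real^3 \<Rightarrow> real) \<Rightarrow> real \<Rightarrow> event \<Rightarrow> real^(3 option)^(3 option)"
  where "kt_metric V c p = (\<chi> \<mu> \<nu>. if \<mu> \<noteq> \<nu> then 0
      else if \<mu> = None then - 1 / (kt_factor V c p)\<^sup>2
      else (kt_factor V c p)\<^sup>2)"

text \<open>The orbits of \<open>\<partial>/\<partial>T\<close> are labelled by their spatial coordinates.\<close>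

definition retraction_projection :: "(real \<Rightarrow> event) \<Rightarrow> real \<Rightarrow> real^3"
  where "retraction_projection \<gamma> = (\<lambda>s. space_part (\<gamma> s))"

text \<open>Null curves of the metric, inside the region where it is defined, parametrised by the
  Euclidean arc length of the spatial part in the direction of increasing \<open>T\<close>. By
  \<open>kt_null_vector_iff\<close> below, the last two conditions amount to
  \<open>dT/ds = (V + c T)\<^sup>2\<close>.\<close>

definition kt_null_curve ::
    "(real^3 \<Rightarrow> real) \<Rightarrow> real \<Rightarrow> (real^3) set \<Rightarrow> real set \<Rightarrow> (real \<Rightarrow> event) \<Rightarrow> bool"
  where "kt_null_curve V c U I \<gamma> \<longleftrightarrow> (\<forall>s\<in>I.
    space_part (\<gamma> s) \<in> U \<and> kt_factor V c (\<gamma> s) \<noteq> 0 \<and>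
    \<gamma> differentiable (at s) \<and>
    norm (dds (retraction_projection \<gamma>) s) = 1 \<and>
    dds \<gamma> s \<bullet> (kt_metric V c (\<gamma> s) *v dds \<gamma> s) = 0 \<and>
    time_part (dds \<gamma> s) > 0)"

lemma sum_UNIV_option: "(\<Sum>\<mu>\<in>UNIV. f \<mu>) = f None + (\<Sum>i\<in>UNIV. f (Some i))"
  for f :: "'n::finite option \<Rightarrow> real"
  by (simp add: UNIV_option_conv sum.reindex)

lemma kt_null_vector_iff:
  assumes "kt_factor V c p \<noteq> 0" and "norm (space_part v) = 1"
  shows "(v \<bullet> (kt_metric V c p *v v) = 0 \<and> time_part v > 0) \<longleftrightarrow> time_part v = (kt_factor V c p)\<^sup>2"
proof -
  define u where "u = kt_factor V c p"
  have u: "u \<noteq> 0" using assms by (simp add: u_def)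
  have "(\<Sum>i\<in>UNIV. (v $ Some i)\<^sup>2) = 1"
    using assms(2) by (simp add: norm_vec_def L2_set_def space_part_def)
  moreover have "v \<bullet> (kt_metric V c p *v v)
      = - (time_part v)\<^sup>2 / u\<^sup>2 + u\<^sup>2 * (\<Sum>i\<in>UNIV. (v $ Some i)\<^sup>2)"
    by (simp add: inner_vec_def matrix_vector_mult_def kt_metric_def sum_UNIV_option u_def
        time_part_def power2_eq_square sum_3 algebra_simps)
  ultimately have *: "v \<bullet> (kt_metric V c p *v v) = - (time_part v)\<^sup>2 / u\<^sup>2 + u\<^sup>2"
    by simp
  have "v \<bullet> (kt_metric V c p *v v) = 0 \<longleftrightarrow> (time_part v)\<^sup>2 = (u\<^sup>2)\<^sup>2"
    unfolding * using u by (auto simp: field_simps power2_eq_square)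
  then show ?thesis
    using u unfolding u_def [symmetric]
    by (metis less_eq_real_def power2_eq_iff_nonneg zero_le_power2 zero_less_power2)
qed


section \<open>The two systems of equations\<close>

definition satisfies_star ::
    "(real^3 \<Rightarrow> real) \<Rightarrow> real \<Rightarrow> real \<Rightarrow> real set \<Rightarrow> (real \<Rightarrow> event) \<Rightarrow> bool"
  where "satisfies_star V c l I \<gamma> \<longleftrightarrow> (let x = retraction_projection \<gamma> in
    \<forall>s\<in>I. x differentiable (at s) \<and> dds x differentiable (at s) \<and>
      dds (dds x) s
      = (2 / kt_factor V c (\<gamma> s)) *\<^sub>R (dds x s \<times> (grad V (x s) \<times> dds x s))
        + l *\<^sub>R (dds x s \<times> grad V (x s)))"

definition transverse_on :: "(real^3 \<Rightarrow> real) \<Rightarrow> real set \<Rightarrow> (real \<Rightarrow> real^3) \<Rightarrow> bool"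
  where "transverse_on V I x \<longleftrightarrow> (\<forall>s\<in>I. dds x s \<times> grad V (x s) \<noteq> 0)"

text \<open>The right-hand side of the third-order system. The first term in the square bracket is
  \<open>1/2 (x''\<bullet>\<nabla>V) (x'\<bullet>\<nabla>V) / |x' \<times> \<nabla>V|\<^sup>2\<close> times \<open>x' \<times> \<nabla>V\<close>, which is what differentiating the
  second-order equation and eliminating \<open>T\<close> and \<open>\<lambda>\<close> yields. The formula in the literature has
  \<open>x'' \<times> \<nabla>V\<close> without the factor \<open>1/2\<close> in this place, which is a misprint: it is not dimensionally
  homogeneous, and since \<open>x' \<bullet> x''' = - |x''|\<^sup>2\<close> for unit speed it would force
  \<open>(x''\<bullet>\<nabla>V) (x'\<bullet>\<nabla>V) (x''\<bullet>(x' \<times> \<nabla>V)) = 0\<close>. The term is irrelevant when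
  \<open>x''\<bullet>(x' \<times> \<nabla>V) = 0\<close>.\<close>

definition third_order_rhs :: "(real^3 \<Rightarrow> real) \<Rightarrow> real \<Rightarrow> (real \<Rightarrow> real^3) \<Rightarrow> real \<Rightarrow> real^3"
  where "third_order_rhs V c x s = (let
      x1 = dds x s; x2 = dds (dds x) s; W = grad V (x s);
      dW = dds (\<lambda>t. grad V (x t)) s;
      N = (norm (x1 \<times> W))\<^sup>2
    in - ((norm x2)\<^sup>2 *\<^sub>R x1)
       - (3/2 * ((x2 \<bullet> W) / N) * (x1 \<bullet> W)) *\<^sub>R x2
       - (2 * c) *\<^sub>R (x1 \<times> (W \<times> x1))
       + ((x2 \<bullet> W) / N) *\<^sub>R (x1 \<times> (dW \<times> x1))
       + ((x2 \<bullet> (x1 \<times> W)) / N) *\<^sub>R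
           ((1/2 * ((x2 \<bullet> W) / N) * (x1 \<bullet> W)) *\<^sub>R (x1 \<times> W)
            + ((x1 \<times> W) \<bullet> x2) *\<^sub>R x1
            + dds (\<lambda>t. dds x t \<times> grad V (x t)) s))"

text \<open>Integral curves are parametrised by arc length and run where the denominators of the system
  do not vanish.\<close>

definition third_order_integral_curve ::
    "(real^3 \<Rightarrow> real) \<Rightarrow> real \<Rightarrow> (real^3) set \<Rightarrow> real set \<Rightarrow> (real \<Rightarrow> real^3) \<Rightarrow> bool"
  where "third_order_integral_curve V c U I x \<longleftrightarrow>
    transverse_on V I x \<and>
    (\<forall>s\<in>I. x s \<in> U \<and> x differentiable (at s) \<and> dds x differentiable (at s) \<and>
      dds (dds x) differentiable (at s) \<and>
      norm (dds x s) = 1 \<and>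
      dds (dds (dds x)) s = third_order_rhs V c x s)"

text \<open>By the second-order equation \<open>x''\<bullet>\<nabla>V = 2 |x' \<times> \<nabla>V|\<^sup>2 / (V + c T)\<close>. An integral curve of the
  third-order system may cross \<open>x''\<bullet>\<nabla>V = 0\<close>, but there \<open>T\<close> would be infinite, so that it leaves
  the projection of the spacetime: only the pieces between such points are projections.\<close>

definition finite_time_on :: "(real^3 \<Rightarrow> real) \<Rightarrow> real set \<Rightarrow> (real \<Rightarrow> real^3) \<Rightarrow> bool"
  where "finite_time_on V I x \<longleftrightarrow> (\<forall>s\<in>I. dds (dds x) s \<bullet> grad V (x s) \<noteq> 0)"

end

theory Submission
  imports Defs
begin

text \<open>Along a null curve \<open>u = V + c T\<close> satisfies \<open>u' = x' \<bullet> \<nabla>V + c u\<^sup>2\<close>. Write \<open>P = x' \<times> (\<nabla>V \<times> x')\<close> and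
  \<open>n = x' \<times> \<nabla>V\<close>, both orthogonal to \<open>x'\<close> and to each other. Any unit-speed curve with
  \<open>x'' \<bullet> \<nabla>V \<noteq> 0\<close> and \<open>n \<noteq> 0\<close> satisfies \<open>x'' = (2/u) P + \<lambda> n\<close> for the functions
  \<open>u = 2 |n|\<^sup>2 / (x'' \<bullet> \<nabla>V)\<close> and \<open>\<lambda> = (x'' \<bullet> n) / |n|\<^sup>2\<close>, and differentiating this shows that \<open>x'''\<close>
  differs from the right-hand side of the third-order system by
  \<open>- (2/u\<^sup>2) (u' - x' \<bullet> \<nabla>V - c u\<^sup>2) P + \<lambda>' n\<close>. As \<open>P\<close> and \<open>n\<close> are independent, the system says
  precisely that \<open>\<lambda>\<close> is constant and that \<open>T = (u - V) / c\<close> completes \<open>x\<close> to a null curve. For null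
  curves the time component of the geodesic equation only fixes the non-affine parametrisation,
  and the space components are then the second-order equation with \<open>\<lambda> = 0\<close>.\<close>

section \<open>Vector algebra\<close>

text \<open>For a unit vector \<open>v\<close>, the vector \<open>v \<times> (W \<times> v)\<close>
  is \<open>W - (v \<bullet> W) v\<close>, the part of \<open>W\<close> orthogonal to
  \<open>v\<close>. Its squared length \<open>W \<bullet> W - (v \<bullet> W)^2\<close> is also that
  of \<open>v \<times> W\<close>, which is orthogonal to both \<open>v\<close> and
  \<open>W\<close>.\<close>

lemma triple_cross_unit:
  fixes v W :: "real^3"
  assumes "norm v = 1"
  shows "(v \<times> (W \<times> v)) \<bullet> W = (norm (v \<times> W))\<^sup>2"
    and "(v \<times> (W \<times> v)) \<bullet> v = 0"
    and "(v \<times> (W \<times> v)) \<bullet> (v \<times> W) = 0"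
    and "(norm (v \<times> (W \<times> v)))\<^sup>2 = (norm (v \<times> W))\<^sup>2"
proof -
  have v: "v \<bullet> v = 1" using assms by (simp add: norm_eq_1)
  have N: "(norm (v \<times> W))\<^sup>2 = W \<bullet> W - (v \<bullet> W)\<^sup>2"
    using norm_cross_dot[of v W] assms by (simp add: power2_norm_eq_inner)
  show "(v \<times> (W \<times> v)) \<bullet> W = (norm (v \<times> W))\<^sup>2"
    unfolding N Lagrange by (simp add: v inner_diff_left power2_eq_square)
  show "(v \<times> (W \<times> v)) \<bullet> v = 0"
    by (simp add: dot_cross_self)
  show "(v \<times> (W \<times> v)) \<bullet> (v \<times> W) = 0"
    unfolding Lagrange by (simp add: inner_diff_left dot_cross_self)
  show "(norm (v \<times> (W \<times> v)))\<^sup>2 = (norm (v \<times> W))\<^sup>2"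
    unfolding N Lagrange power2_norm_eq_inner[of "_ - _"]
    by (simp add: v inner_diff_left inner_diff_right inner_commute power2_eq_square algebra_simps)
qed

text \<open>When \<open>v \<times> W\<close> is nonzero, \<open>v \<times> (W \<times> v)\<close>
  and \<open>v \<times> W\<close> form an orthogonal basis of the plane orthogonal to
  \<open>v\<close>, both of squared length \<open>N\<close>. The first coefficient can be taken with
  \<open>W\<close> itself because \<open>a\<close> is orthogonal to \<open>v\<close>.\<close>

lemma orthogonal_to_unit_decomposition:
  fixes v a W :: "real^3"
  assumes v: "norm v = 1" and a: "v \<bullet> a = 0" and n: "v \<times> W \<noteq> 0"
  defines "N \<equiv> (norm (v \<times> W))\<^sup>2"
  shows "a = ((a \<bullet> W) / N) *\<^sub>R (v \<times> (W \<times> v)) + ((a \<bullet> (v \<times> W)) / N) *\<^sub>R (v \<times> W)"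
proof -
  have N: "N \<noteq> 0" "(v \<times> W) \<bullet> (v \<times> W) = N" using n by (simp_all add: N_def power2_norm_eq_inner)
  \<comment> \<open>Evaluate \<open>(v \<times> W) \<times> (a \<times> (v \<times> W))\<close> in
    two ways: expanding the outer product gives the left-hand side, and expanding the inner one
    leaves a multiple of \<open>v\<close>.\<close>
  have "N *\<^sub>R a - (a \<bullet> (v \<times> W)) *\<^sub>R (v \<times> W) = (v \<times> W) \<times> (a \<times> (v \<times> W))"
    by (simp add: Lagrange[of "v \<times> W"] N inner_commute)
  also have "a \<times> (v \<times> W) = (a \<bullet> W) *\<^sub>R v"
    using a by (simp add: Lagrange inner_commute)
  also have "(v \<times> W) \<times> \<dots> = (a \<bullet> W) *\<^sub>R (v \<times> (W \<times> v))"
    by (metis cross_mult_right cross_minus_left cross_minus_right cross_skew minus_minus)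
  finally have "N *\<^sub>R a = (a \<bullet> W) *\<^sub>R (v \<times> (W \<times> v)) + (a \<bullet> (v \<times> W)) *\<^sub>R (v \<times> W)"
    by (simp add: diff_eq_eq)
  then have "(1/N) *\<^sub>R (N *\<^sub>R a) = (1/N) *\<^sub>R \<dots>" by simp
  then show ?thesis using N by (simp add: scaleR_add_right)
qed

text \<open>Here \<open>v, a, W, D, Q\<close> stand for \<open>x', x'', \<nabla>V, (\<nabla>V)', (x' \<times> \<nabla>V)'\<close>. The left-hand side is the derivative
  of the right-hand side of the second-order equation for constant \<open>l\<close>; the last term on the right
  vanishes iff \<open>u\<close> evolves as \<open>V + c T\<close> does along a null curve.\<close>

lemma third_order_identity:
  fixes v a W D Q :: "real^3"
  assumes v: "norm v = 1" and n: "v \<times> W \<noteq> 0" and u: "u \<noteq> 0"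
    and a: "a = (2 / u) *\<^sub>R (v \<times> (W \<times> v)) + l *\<^sub>R (v \<times> W)"
  defines "N \<equiv> (norm (v \<times> W))\<^sup>2"
  shows "(2 / u) *\<^sub>R (D - (a \<bullet> W + v \<bullet> D) *\<^sub>R v - (v \<bullet> W) *\<^sub>R a)
           - (2 * u' / u\<^sup>2) *\<^sub>R (v \<times> (W \<times> v)) + l *\<^sub>R Q
    = - ((norm a)\<^sup>2 *\<^sub>R v)
       - (3/2 * ((a \<bullet> W) / N) * (v \<bullet> W)) *\<^sub>R a
       - (2 * c) *\<^sub>R (v \<times> (W \<times> v))
       + ((a \<bullet> W) / N) *\<^sub>R (v \<times> (D \<times> v))
       + ((a \<bullet> (v \<times> W)) / N) *\<^sub>R
           ((1/2 * ((a \<bullet> W) / N) * (v \<bullet> W)) *\<^sub>R (v \<times> W) + ((v \<times> W) \<bullet> a) *\<^sub>R v + Q)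
       - (2 / u\<^sup>2 * (u' - v \<bullet> W - c * u\<^sup>2)) *\<^sub>R (v \<times> (W \<times> v))"
proof -
  define P n where "P = v \<times> (W \<times> v)" and "n = v \<times> W"
  have N: "N \<noteq> 0" using n by (simp add: N_def)
  have vv: "v \<bullet> v = 1" using v by (simp add: norm_eq_1)
  note P = triple_cross_unit[OF v, of W, folded P_def n_def]
  have nn: "n \<bullet> n = N" by (simp add: N_def n_def power2_norm_eq_inner)
  have PP: "P \<bullet> P = N" using P(4) nn by (simp add: power2_norm_eq_inner)
  have aeq: "a = (2 / u) *\<^sub>R P + l *\<^sub>R n" using a by (simp add: P_def n_def)
  have aW: "a \<bullet> W = 2 * N / u"
    using P(1) by (simp add: aeq inner_add_left N_def n_def dot_cross_self)
  have an: "a \<bullet> n = l * N" "n \<bullet> a = l * N"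
    using P(3) by (simp_all add: aeq inner_add_left inner_add_right inner_commute nn)
  have aa: "(norm a)\<^sup>2 = 4 * N / u\<^sup>2 + l\<^sup>2 * N"
    unfolding power2_norm_eq_inner aeq using P(3)
    by (simp add: inner_add_left inner_add_right inner_commute[of n P] nn PP power2_eq_square)
  have DP: "v \<times> (D \<times> v) = D - (v \<bullet> D) *\<^sub>R v" by (simp add: Lagrange vv)
  \<comment> \<open>With the scalars expressed through \<open>u\<close>, \<open>l\<close> and
    \<open>N\<close>, both sides are combinations of \<open>v\<close>, \<open>P\<close>,
    \<open>n\<close>, \<open>D\<close>, \<open>Q\<close> and can be compared componentwise. The
    coefficient 3/2 arises by absorbing the \<open>P\<close> part produced by
    \<open>v \<bullet> W\<close> in \<open>u'\<close> into a multiple of \<open>a\<close>; this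
    overshoots by \<open>(l / u) (v \<bullet> W) n\<close>, which the 1/2 term compensates.\<close>
  show ?thesis
    unfolding P_def[symmetric] n_def[symmetric] aW an aa DP
    unfolding aeq vec_eq_iff
    using u N by (simp add: field_simps power2_eq_square)
qed

section \<open>Gradients and derivatives along curves\<close>

lemma has_derivative_grad:
  assumes "f differentiable (at x)"
  shows "(f has_derivative (\<lambda>h. grad f x \<bullet> h)) (at x)"
proof -
  let ?D = "frechet_derivative f (at x)"
  have D: "(f has_derivative ?D) (at x)"
    using assms frechet_derivative_works by blast
  then interpret bounded_linear ?D by (rule has_derivative_bounded_linear)
  have "?D h = grad f x \<bullet> h" for h
  proof -
    have "?D h = ?D (\<Sum>i\<in>UNIV. h $ i *\<^sub>R axis i 1)"
      using basis_expansion[of h] by (simp add: scalar_mult_eq_scaleR)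
    also have "\<dots> = (\<Sum>i\<in>UNIV. h $ i * ?D (axis i 1))"
      by (simp add: sum scaleR)
    finally show ?thesis by (simp add: grad_def partial_deriv_def inner_vec_def mult.commute)
  qed
  then have "?D = (\<lambda>h. grad f x \<bullet> h)" by blast
  with D show ?thesis by simp
qed

lemma partial_deriv_eq:
  assumes "(f has_derivative D) (at x)"
  shows "partial_deriv i f x = D (axis i 1)"
  using frechet_derivative_at[OF assms] by (simp add: partial_deriv_def)

text \<open>Lets the time component of a curve of events be differentiated separately from the
  spatial ones.\<close>

lemma has_vector_derivative_vec_nth_iff:
  fixes f :: "real \<Rightarrow> real^'n"
  shows "(f has_vector_derivative f') (at s) \<longleftrightarrow>
    (\<forall>i. ((\<lambda>t. f t $ i) has_real_derivative f' $ i) (at s))"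
  unfolding has_vector_derivative_def has_field_derivative_def
  by (subst has_derivative_componentwise_within)
    (simp add: Basis_vec_def inner_axis mult_commute_abs)

lemma differentiable_vec_nth_iff:
  fixes f :: "'a::euclidean_space \<Rightarrow> real^'n"
  shows "f differentiable (at x) \<longleftrightarrow> (\<forall>i. (\<lambda>y. f y $ i) differentiable (at x))"
  by (subst differentiable_componentwise_within) (simp add: Basis_vec_def inner_axis)

lemma dds_eq: "(f has_vector_derivative f') (at s) \<Longrightarrow> dds f s = f'"
  by (simp add: dds_def vector_derivative_at)

lemma has_vector_derivative_dds:
  "f differentiable (at s) \<Longrightarrow> (f has_vector_derivative dds f s) (at s)"
  by (simp add: dds_def vector_derivative_works)

lemma differentiable_at_congI:
  assumes "open I" "s \<in> I" "\<And>t. t \<in> I \<Longrightarrow> f t = g t" "g differentiable (at s)"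
  shows "f differentiable (at s)"
  using assms unfolding differentiable_def by (metis has_derivative_transform_within_open)

lemma C2_on_grad_differentiable:
  assumes "C2_on V U" "p \<in> U"
  shows "grad V differentiable (at p)"
  using assms unfolding differentiable_vec_nth_iff by (simp add: grad_def C2_on_def)

lemma has_real_derivative_along_curve:
  assumes "V differentiable (at (x s))" "(x has_vector_derivative x') (at s)"
  shows "((\<lambda>t. V (x t)) has_real_derivative x' \<bullet> grad V (x s)) (at s)"
proof -
  have "((\<lambda>t. V (x t)) has_derivative (\<lambda>h. grad V (x s) \<bullet> (h *\<^sub>R x'))) (at s)"
    using has_derivative_compose[OF assms(2)[unfolded has_vector_derivative_def]
        has_derivative_grad[OF assms(1)]] .
  then show ?thesis
    by (simp add: has_field_derivative_def inner_commute mult_commute_abs)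
qed

lemma differentiable_along_curve:
  fixes x :: "real \<Rightarrow> 'a::real_normed_vector"
  assumes "f differentiable (at (x s))" "x differentiable (at s)"
  shows "(\<lambda>t. f (x t)) differentiable (at s)"
  using differentiable_chain_at[OF assms(2,1)] by (simp add: o_def)

text \<open>\<open>v \<bullet> v\<close> is constant on the open set, so its derivative, twice
  \<open>v \<bullet> a\<close>, vanishes.\<close>

lemma unit_speed_orthogonal:
  fixes v :: "real \<Rightarrow> 'a::real_inner"
  assumes "open I" "s \<in> I" "\<And>t. t \<in> I \<Longrightarrow> norm (v t) = 1"
    and v: "(v has_vector_derivative a) (at s)"
  shows "v s \<bullet> a = 0"
proof -
  have "((\<lambda>t. v t \<bullet> v t) has_vector_derivative (v s \<bullet> a + a \<bullet> v s)) (at s)"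
    using bounded_bilinear.has_vector_derivative[OF bounded_bilinear_inner v v] .
  moreover have "((\<lambda>t. v t \<bullet> v t) has_vector_derivative 0) (at s)"
    by (rule has_vector_derivative_transform_within_open[OF has_vector_derivative_const[of 1]
          assms(1,2)])
      (simp add: assms(3) flip: power2_norm_eq_inner)
  ultimately show ?thesis
    using vector_derivative_unique_at by (fastforce simp: inner_commute)
qed

lemma has_vector_derivative_cross3:
  assumes "(f has_vector_derivative f') (at s)" "(g has_vector_derivative g') (at s)"
  shows "((\<lambda>t. f t \<times> g t) has_vector_derivative f s \<times> g' + f' \<times> g s) (at s)"
  using bounded_bilinear.has_vector_derivative[OF bilinear_conv_bounded_bilinear[THEN iffD1, OF bilinear_cross] assms] .

section \<open>Christoffel symbols of the Kastor-Traschen metric\<close>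

text \<open>\<open>matrix_inv\<close> is defined by choice, so the witness \<open>B\<close> is first
  used to obtain its two inverse laws; associativity then gives uniqueness.\<close>

lemma matrix_inv_eqI:
  fixes A B :: "'a::field^'n^'n"
  assumes "A ** B = mat 1" "B ** A = mat 1"
  shows "matrix_inv A = B"
proof -
  have inv: "A ** matrix_inv A = mat 1 \<and> matrix_inv A ** A = mat 1"
    unfolding matrix_inv_def
    by (rule someI[where P = "\<lambda>X. A ** X = mat 1 \<and> X ** A = mat 1" and x = B]) (simp add: assms)
  have "matrix_inv A = (B ** A) ** matrix_inv A"
    by (simp add: assms(2))
  also have "\<dots> = B"
    by (simp add: inv flip: matrix_mul_assoc)
  finally show ?thesis .
qed

lemma diagonal_matrix_mult:
  fixes a b :: "'n::finite \<Rightarrow> 'a::semiring_1"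
  shows "(\<chi> i j. if i \<noteq> j then 0 else a i) ** (\<chi> i j. if i \<noteq> j then 0 else b i)
    = (\<chi> i j. if i \<noteq> j then 0 else a i * b i)"
proof -
  have "(\<Sum>k\<in>UNIV. (if i \<noteq> k then 0 else a i) * (if k \<noteq> j then 0 else b k))
      = (\<Sum>k\<in>UNIV. if k = i then (if i \<noteq> j then 0 else a i * b i) else 0)" for i j
    by (rule sum.cong) auto
  then show ?thesis
    by (simp add: vec_eq_iff matrix_matrix_mult_def)
qed

lemma matrix_inv_kt_metric:
  assumes "kt_factor V c p \<noteq> 0"
  shows "matrix_inv (kt_metric V c p) = (\<chi> \<mu> \<nu>. if \<mu> \<noteq> \<nu> then 0
      else if \<mu> = None then - (kt_factor V c p)\<^sup>2
      else 1 / (kt_factor V c p)\<^sup>2)"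
  by (rule matrix_inv_eqI; unfold kt_metric_def diagonal_matrix_mult)
     (simp_all add: assms mat_def vec_eq_iff)

section \<open>Coordinate derivatives of the metric\<close>

lemma bounded_linear_space_part: "bounded_linear space_part"
  by (intro linear_conv_bounded_linear[THEN iffD1] linearI)
    (simp_all add: space_part_def vec_eq_iff)

lemma bounded_linear_time_part: "bounded_linear time_part"
  unfolding time_part_def by (rule bounded_linear_vec_nth)

lemma kt_factor_has_derivative:
  assumes "V differentiable (at (space_part p))"
  shows "(kt_factor V c has_derivative
    (\<lambda>h. grad V (space_part p) \<bullet> space_part h + c * time_part h)) (at p)"
proof -
  have "((\<lambda>q. V (space_part q)) has_derivative (\<lambda>h. grad V (space_part p) \<bullet> space_part h)) (at p)"
    using has_derivative_compose[OF bounded_linear_imp_has_derivative[OF bounded_linear_space_part]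
        has_derivative_grad[OF assms]] .
  then show ?thesis
    unfolding kt_factor_def
    by (intro has_derivative_add has_derivative_mult_right bounded_linear_imp_has_derivative
        bounded_linear_time_part)
qed

text \<open>These are the coordinate derivatives of \<open>kt_factor\<close>, gathered into one
  function of the index so that the metric entries can be differentiated uniformly.\<close>

definition kt_factor_partial :: "(real^3 \<Rightarrow> real) \<Rightarrow> real \<Rightarrow> event \<Rightarrow> 3 option \<Rightarrow> real"
  where "kt_factor_partial V c p \<mu> = (case \<mu> of None \<Rightarrow> c | Some i \<Rightarrow> grad V (space_part p) $ i)"

text \<open>Every diagonal entry is a function of \<open>u = V + c T\<close> alone, so the chain
  rule applies to \<open>- 1 / u^2\<close> and to \<open>u^2\<close>.\<close>

lemma partial_deriv_kt_metric:
  assumes V: "V differentiable (at (space_part p))" and u: "kt_factor V c p \<noteq> 0"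
  shows "partial_deriv \<mu> (\<lambda>q. kt_metric V c q $ \<sigma> $ \<nu>) p =
    (if \<sigma> \<noteq> \<nu> then 0
     else if \<sigma> = None then 2 * kt_factor_partial V c p \<mu> / kt_factor V c p ^ 3
     else 2 * kt_factor V c p * kt_factor_partial V c p \<mu>)"
proof -
  let ?D = "\<lambda>h. grad V (space_part p) \<bullet> space_part h + c * time_part h"
  note D = kt_factor_has_derivative[OF V, of c]
  have slope: "?D (axis \<mu> 1) = kt_factor_partial V c p \<mu>"
  proof (cases \<mu>)
    case (Some i)
    then have "space_part (axis \<mu> 1) = axis i 1" "time_part (axis \<mu> 1) = 0"
      by (simp_all add: space_part_def time_part_def axis_def vec_eq_iff)
    then show ?thesis by (simp add: kt_factor_partial_def Some inner_axis)
  next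
    case None
    then have "space_part (axis \<mu> 1) = 0" "time_part (axis \<mu> 1) = 1"
      by (simp_all add: space_part_def time_part_def axis_def vec_eq_iff)
    then show ?thesis by (simp add: kt_factor_partial_def None)
  qed
  consider "\<sigma> \<noteq> \<nu>" | "\<sigma> = \<nu>" "\<sigma> = None" | "\<sigma> = \<nu>" "\<sigma> \<noteq> None" by blast
  then show ?thesis
  proof cases
    case 1
    then show ?thesis
      by (simp add: kt_metric_def partial_deriv_eq[OF has_derivative_const])
  next
    case 2
    have "((\<lambda>q. - 1 / (kt_factor V c q)\<^sup>2) has_derivative
        (\<lambda>h. 2 * ?D h / kt_factor V c p ^ 3)) (at p)"
      by (rule derivative_eq_intros D refl | simp add: u)+
        (simp add: u fun_eq_iff field_simps power2_eq_square power3_eq_cube)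
    from partial_deriv_eq[OF this, of \<mu>] show ?thesis
      using 2 slope by (simp add: kt_metric_def)
  next
    case 3
    have "((\<lambda>q. (kt_factor V c q)\<^sup>2) has_derivative
        (\<lambda>h. 2 * kt_factor V c p * ?D h)) (at p)"
      by (rule derivative_eq_intros D refl)+ (simp add: fun_eq_iff)
    moreover obtain k where "\<sigma> = Some k" using 3 by blast
    ultimately show ?thesis
      using 3 slope partial_deriv_eq[of _ _ p \<mu>] by (simp add: kt_metric_def)
  qed
qed

section \<open>Connection coefficients and their quadratic form\<close>

lemma christoffel_diagonal:
  assumes "matrix_inv (g p) = (\<chi> i j. if i \<noteq> j then 0 else a i)"
  shows "christoffel g p \<kappa> \<mu> \<nu> = a \<kappa> / 2 *
      (partial_deriv \<mu> (\<lambda>q. g q $ \<kappa> $ \<nu>) p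
       + partial_deriv \<nu> (\<lambda>q. g q $ \<kappa> $ \<mu>) p
       - partial_deriv \<kappa> (\<lambda>q. g q $ \<mu> $ \<nu>) p)"
proof -
  have "(\<Sum>\<sigma>\<in>UNIV. (if \<kappa> \<noteq> \<sigma> then 0 else a \<kappa>) * F \<sigma>) = a \<kappa> * F \<kappa>" for F
  proof -
    have "(\<Sum>\<sigma>\<in>UNIV. (if \<kappa> \<noteq> \<sigma> then 0 else a \<kappa>) * F \<sigma>)
        = (\<Sum>\<sigma>\<in>UNIV. if \<sigma> = \<kappa> then a \<kappa> * F \<kappa> else 0)"
      by (rule sum.cong) auto
    then show ?thesis by simp
  qed
  then show ?thesis by (simp add: christoffel_def assms)
qed

text \<open>The powers come from pairing an inverse entry, \<open>- u^2\<close> or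
  \<open>1 / u^2\<close>, with a derivative carrying \<open>u\<close> or \<open>1 / u^3\<close>.
  Writing \<open>r\<close> for \<open>1 / u\<close> keeps the later contraction with the velocity
  polynomial.\<close>

lemma christoffel_kt_metric:
  assumes V: "V differentiable (at (space_part p))" and u: "kt_factor V c p \<noteq> 0"
  defines "W \<equiv> grad V (space_part p)" and "r \<equiv> inverse (kt_factor V c p)"
  shows "christoffel (kt_metric V c) p None None None = - (c * r)"
    and "christoffel (kt_metric V c) p None None (Some k) = - (W $ k * r)"
    and "christoffel (kt_metric V c) p None (Some j) None = - (W $ j * r)"
    and "christoffel (kt_metric V c) p None (Some j) (Some k)
      = (if j = k then c * kt_factor V c p ^ 3 else 0)"
    and "christoffel (kt_metric V c) p (Some i) None None = - (W $ i * r ^ 5)"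
    and "christoffel (kt_metric V c) p (Some i) None (Some k) = (if i = k then c * r else 0)"
    and "christoffel (kt_metric V c) p (Some i) (Some j) None = (if i = j then c * r else 0)"
    and "christoffel (kt_metric V c) p (Some i) (Some j) (Some k)
      = ((if i = j then W $ k else 0) + (if i = k then W $ j else 0)
         - (if j = k then W $ i else 0)) * r"
  unfolding christoffel_diagonal[of "kt_metric V c", OF matrix_inv_kt_metric[OF u]]
    partial_deriv_kt_metric[OF V u] kt_factor_partial_def r_def
  using u by (simp_all add: W_def field_simps eval_nat_numeral)

text \<open>The velocity terms of the geodesic equation for an arbitrary vector; the null condition
  and unit spatial speed are substituted only later.\<close>

lemma christoffel_kt_quadratic:
  fixes v :: event
  assumes V: "V differentiable (at (space_part p))" and u: "kt_factor V c p \<noteq> 0"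
  defines "W \<equiv> grad V (space_part p)" and "r \<equiv> inverse (kt_factor V c p)"
  defines "Q \<equiv> (\<lambda>\<kappa>. \<Sum>\<mu>\<in>UNIV. \<Sum>\<nu>\<in>UNIV.
      christoffel (kt_metric V c) p \<kappa> \<mu> \<nu> * v $ \<mu> * v $ \<nu>)"
  shows "Q None = - ((c * (time_part v)\<^sup>2 + 2 * (space_part v \<bullet> W) * time_part v) * r)
      + c * kt_factor V c p ^ 3 * (norm (space_part v))\<^sup>2"
    and "Q (Some i) = (2 * c * time_part v * v $ Some i + 2 * (space_part v \<bullet> W) * v $ Some i
      - W $ i * (norm (space_part v))\<^sup>2 - W $ i * (time_part v)\<^sup>2 * r ^ 4) * r"
proof -
  note Q = Q_def christoffel_kt_metric[OF V u, folded W_def r_def] sum_UNIV_option sum_3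
  have norm: "(norm (space_part v))\<^sup>2 = v $ Some 1 * v $ Some 1 + v $ Some 2 * v $ Some 2 + v $ Some 3 * v $ Some 3"
    by (simp add: power2_norm_eq_inner inner_vec_def sum_3 space_part_def)
  have inner: "space_part v \<bullet> W = v $ Some 1 * W $ 1 + v $ Some 2 * W $ 2 + v $ Some 3 * W $ 3"
    by (simp add: inner_vec_def sum_3 space_part_def)
  show "Q None = - ((c * (time_part v)\<^sup>2 + 2 * (space_part v \<bullet> W) * time_part v) * r)
      + c * kt_factor V c p ^ 3 * (norm (space_part v))\<^sup>2"
    unfolding norm inner time_part_def
    unfolding power2_eq_square
    by (simp add: Q algebra_simps)
  show "Q (Some i) = (2 * c * time_part v * v $ Some i + 2 * (space_part v \<bullet> W) * v $ Some i
      - W $ i * (norm (space_part v))\<^sup>2 - W $ i * (time_part v)\<^sup>2 * r ^ 4) * r"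
    unfolding norm inner time_part_def
    unfolding power2_eq_square
    using exhaust_3[of i]
    by (elim disjE; simp add: Q; simp add: algebra_simps eval_nat_numeral)
qed

section \<open>Null curves\<close>

lemma kt_null_curveD:
  assumes "kt_null_curve V c U I \<gamma>" "s \<in> I"
  defines "x \<equiv> retraction_projection \<gamma>"
  shows "x s \<in> U" "kt_factor V c (\<gamma> s) \<noteq> 0" "(\<gamma> has_vector_derivative dds \<gamma> s) (at s)"
    "norm (dds x s) = 1" "(x has_vector_derivative dds x s) (at s)"
    "space_part (dds \<gamma> s) = dds x s" "time_part (dds \<gamma> s) = (kt_factor V c (\<gamma> s))\<^sup>2"
proof -
  note * = assms(1)[unfolded kt_null_curve_def, rule_format, OF assms(2), folded x_def]
  show "x s \<in> U" "norm (dds x s) = 1" and u: "kt_factor V c (\<gamma> s) \<noteq> 0"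
    using * by (simp_all add: x_def retraction_projection_def)
  show \<gamma>: "(\<gamma> has_vector_derivative dds \<gamma> s) (at s)"
    using * has_vector_derivative_dds by blast
  have "(x has_vector_derivative space_part (dds \<gamma> s)) (at s)"
    unfolding x_def retraction_projection_def
    by (rule bounded_linear.has_vector_derivative[OF bounded_linear_space_part \<gamma>])
  then show "(x has_vector_derivative dds x s) (at s)" and sp: "space_part (dds \<gamma> s) = dds x s"
    using dds_eq by force+
  show "time_part (dds \<gamma> s) = (kt_factor V c (\<gamma> s))\<^sup>2"
    using kt_null_vector_iff[OF u, of "dds \<gamma> s"] * by (simp add: sp)
qed

text \<open>The chain rule gives the contribution of \<open>V\<close>; the other term is
  \<open>c\<close> times \<open>dT/ds = u^2\<close>.\<close>

lemma kt_factor_along_null_curve: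
  assumes "kt_null_curve V c U I \<gamma>" "s \<in> I" "\<And>p. p \<in> U \<Longrightarrow> V differentiable (at p)"
  defines "x \<equiv> retraction_projection \<gamma>"
  shows "((\<lambda>t. kt_factor V c (\<gamma> t)) has_real_derivative
    dds x s \<bullet> grad V (x s) + c * (kt_factor V c (\<gamma> s))\<^sup>2) (at s)"
proof -
  note * = kt_null_curveD[OF assms(1,2), folded x_def]
  have "((\<lambda>t. V (x t)) has_real_derivative dds x s \<bullet> grad V (x s)) (at s)"
    by (rule has_real_derivative_along_curve[OF assms(3)[OF *(1)] *(5)])
  moreover have "((\<lambda>t. time_part (\<gamma> t)) has_real_derivative (kt_factor V c (\<gamma> s))\<^sup>2) (at s)"
    using bounded_linear.has_vector_derivative[OF bounded_linear_time_part *(3)]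
    by (simp add: *(7) has_real_derivative_iff_has_vector_derivative)
  ultimately show ?thesis
    unfolding kt_factor_def x_def retraction_projection_def
    by (intro DERIV_add DERIV_cmult)
qed

section \<open>Null geodesics\<close>

text \<open>The time component always has the form of a geodesic equation with factor
  \<open>2 c u\<close>. Removing this multiple of the velocity from the spatial components leaves
  the second-order equation with \<open>\<lambda> = 0\<close>.\<close>

lemma kt_null_geodesic_iff_star:
  assumes I: "open I" and V: "\<And>p. p \<in> U \<Longrightarrow> V differentiable (at p)"
    and \<gamma>: "kt_null_curve V c U I \<gamma>"
  shows "geodesic_on (kt_metric V c) I \<gamma> \<longleftrightarrow> satisfies_star V c 0 I \<gamma>"
proof -
  define x u where "x = retraction_projection \<gamma>" and "u = (\<lambda>t. kt_factor V c (\<gamma> t))"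
  note null = kt_null_curveD[OF \<gamma>, folded x_def]
  have u': "(u has_real_derivative dds x s \<bullet> grad V (x s) + c * (u s)\<^sup>2) (at s)" if "s \<in> I" for s
    unfolding u_def x_def by (rule kt_factor_along_null_curve[OF \<gamma> that V])
  have T: "dds \<gamma> t $ None = (u t)\<^sup>2" and X: "dds \<gamma> t $ Some i = dds x t $ i" if "t \<in> I" for t i
    using null(6,7)[OF that] by (auto simp: time_part_def space_part_def vec_eq_iff u_def)
  \<comment> \<open>The null condition makes \<open>T'\<close> equal to \<open>u^2\<close> on the
    open set \<open>I\<close>, so \<open>T''\<close> exists by the first-order evolution of
    \<open>u\<close> alone.\<close>
  have ddT: "((\<lambda>t. dds \<gamma> t $ None) has_real_derivative
      2 * u s * (dds x s \<bullet> grad V (x s) + c * (u s)\<^sup>2)) (at s)" if "s \<in> I" for s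
  proof -
    have "((\<lambda>t. (u t)\<^sup>2) has_real_derivative
        2 * u s * (dds x s \<bullet> grad V (x s) + c * (u s)\<^sup>2)) (at s)"
      using DERIV_power[OF u'[OF that], of 2] by (simp add: mult_ac)
    then show ?thesis
      unfolding has_field_derivative_def
      by (rule has_derivative_transform_within_open[OF _ I that]) (simp add: T)
  qed
  \<comment> \<open>Since \<open>T'\<close> is differentiable in any case, only the spatial
    components decide whether the velocity is.\<close>
  have diff: "dds \<gamma> differentiable (at s) \<longleftrightarrow> dds x differentiable (at s)" if "s \<in> I" for s
  proof -
    have "(\<lambda>t. dds \<gamma> t $ Some i) differentiable (at s) \<longleftrightarrow> (\<lambda>t. dds x t $ i) differentiable (at s)"
      for i
      using differentiable_at_congI[OF I that, of "\<lambda>t. dds \<gamma> t $ Some i" "\<lambda>t. dds x t $ i"]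
        differentiable_at_congI[OF I that, of "\<lambda>t. dds x t $ i" "\<lambda>t. dds \<gamma> t $ Some i"] X
      by auto
    moreover have "(\<lambda>t. dds \<gamma> t $ None) differentiable (at s)"
      using ddT[OF that] real_differentiable_def by blast
    ultimately show ?thesis
      by (simp add: differentiable_vec_nth_iff split_option_all)
  qed
  \<comment> \<open>With \<open>T' = u^2\<close> and unit spatial speed, the gradient terms cancel
    in the time component; in the spatial ones they combine to
    \<open>- (2 / u) (W - (x' \<bullet> W) x')\<close> with \<open>W = \<nabla>V\<close>.\<close>
  have acc: "covariant_acceleration (kt_metric V c) \<gamma> s $ None = 2 * c * u s * dds \<gamma> s $ None"
    "covariant_acceleration (kt_metric V c) \<gamma> s $ Some i = 2 * c * u s * dds \<gamma> s $ Some i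
      + (dds (dds x) s - (2 / u s) *\<^sub>R (dds x s \<times> (grad V (x s) \<times> dds x s))) $ i"
    if s: "s \<in> I" and d: "dds x differentiable (at s)" for s i
  proof -
    have d\<gamma>: "(dds \<gamma> has_vector_derivative dds (dds \<gamma>) s) (at s)"
      using diff[OF s] d has_vector_derivative_dds by blast
    have dT: "dds (dds \<gamma>) s $ None = 2 * u s * (dds x s \<bullet> grad V (x s) + c * (u s)\<^sup>2)"
      using d\<gamma> ddT[OF s] DERIV_unique unfolding has_vector_derivative_vec_nth_iff by blast
    have "((\<lambda>t. dds \<gamma> t $ Some i) has_real_derivative dds (dds \<gamma>) s $ Some i) (at s)"
      using d\<gamma> has_vector_derivative_vec_nth_iff by blast
    then have "((\<lambda>t. dds x t $ i) has_real_derivative dds (dds \<gamma>) s $ Some i) (at s)"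
      unfolding has_field_derivative_def
      by (rule has_derivative_transform_within_open[OF _ I s]) (simp add: X)
    moreover have "((\<lambda>t. dds x t $ i) has_real_derivative dds (dds x) s $ i) (at s)"
      using has_vector_derivative_dds[OF d] has_vector_derivative_vec_nth_iff by blast
    ultimately have dX: "dds (dds \<gamma>) s $ Some i = dds (dds x) s $ i"
      by (rule DERIV_unique)
    have sp: "space_part (\<gamma> s) = x s" by (simp add: x_def retraction_projection_def)
    note Q = christoffel_kt_quadratic[where V = V and p = "\<gamma> s" and c = c and v = "dds \<gamma> s",
        unfolded sp, OF V[OF null(1)[OF s]] null(2)[OF s, unfolded u_def]]
    have unit: "(norm (dds x s))\<^sup>2 = 1" "dds x s \<bullet> dds x s = 1"
      using null(4)[OF s] by (simp_all add: power2_norm_eq_inner[symmetric])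
    show "covariant_acceleration (kt_metric V c) \<gamma> s $ None = 2 * c * u s * dds \<gamma> s $ None"
      using null(2)[OF s] unfolding u_def
      by (simp add: covariant_acceleration_def Q dT T[OF s] null(6,7)[OF s] unit u_def)
        (simp add: field_simps eval_nat_numeral)
    show "covariant_acceleration (kt_metric V c) \<gamma> s $ Some i = 2 * c * u s * dds \<gamma> s $ Some i
        + (dds (dds x) s - (2 / u s) *\<^sub>R (dds x s \<times> (grad V (x s) \<times> dds x s))) $ i"
      using null(2)[OF s] unfolding u_def
      by (simp add: covariant_acceleration_def Q dX X[OF s] null(6,7)[OF s] unit Lagrange
          u_def) (simp add: field_simps eval_nat_numeral)
  qed
  show ?thesis
  proof
    assume geo: "geodesic_on (kt_metric V c) I \<gamma>"
    then obtain f where f: "\<And>s. s \<in> I \<Longrightarrow> covariant_acceleration (kt_metric V c) \<gamma> s = f s *\<^sub>R dds \<gamma> s"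
      by (auto simp: geodesic_on_def)
    have "x differentiable (at s)" "dds x differentiable (at s)"
      "dds (dds x) s = (2 / u s) *\<^sub>R (dds x s \<times> (grad V (x s) \<times> dds x s))" if s: "s \<in> I" for s
    proof -
      show "x differentiable (at s)"
        using null(5)[OF s] by (rule differentiableI_vector)
      show d: "dds x differentiable (at s)"
        using geo diff[OF s] s by (simp add: geodesic_on_def)
      \<comment> \<open>The time component determines \<open>f\<close>, because
        \<open>T' = u^2\<close> is nonzero.\<close>
      have "f s = 2 * c * u s"
        using acc(1)[OF s d] f[OF s] T[OF s] null(2)[OF s] by (auto simp: u_def)
      then show "dds (dds x) s = (2 / u s) *\<^sub>R (dds x s \<times> (grad V (x s) \<times> dds x s))"
        using acc(2)[OF s d] f[OF s] by (simp add: vec_eq_iff)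
    qed
    then show "satisfies_star V c 0 I \<gamma>"
      by (simp add: satisfies_star_def x_def u_def)
  next
    assume star: "satisfies_star V c 0 I \<gamma>"
    then have d: "dds x differentiable (at s)" and
      eq: "dds (dds x) s = (2 / u s) *\<^sub>R (dds x s \<times> (grad V (x s) \<times> dds x s))" if "s \<in> I" for s
      using that by (simp_all add: satisfies_star_def Let_def x_def u_def)
    have "covariant_acceleration (kt_metric V c) \<gamma> s = (2 * c * u s) *\<^sub>R dds \<gamma> s" if s: "s \<in> I" for s
      unfolding vec_eq_iff
    proof
      fix \<mu> :: "3 option"
      show "covariant_acceleration (kt_metric V c) \<gamma> s $ \<mu> = ((2 * c * u s) *\<^sub>R dds \<gamma> s) $ \<mu>"
        using acc[OF s d[OF s]] eq[OF s] by (cases \<mu>) simp_all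
    qed
    then show "geodesic_on (kt_metric V c) I \<gamma>"
      unfolding geodesic_on_def
      using differentiableI_vector[OF null(3)] d diff
      by (auto intro!: exI[of _ "\<lambda>s. 2 * c * u s"])
  qed
qed

section \<open>The third-order system\<close>

text \<open>Here \<open>u\<close> and \<open>l\<close> are arbitrary differentiable functions, so
  the formula serves both directions: the two correction terms vanish for the projection of a
  solution, and for a solution of the third-order system they are the obstruction to lifting
  it.\<close>

lemma star_third_derivative:
  fixes x :: "real \<Rightarrow> real^3" and u l :: "real \<Rightarrow> real"
  assumes I: "open I" "s \<in> I"
    and x1: "\<And>t. t \<in> I \<Longrightarrow> x differentiable (at t)"
    and x2: "\<And>t. t \<in> I \<Longrightarrow> dds x differentiable (at t)"
    and unit: "\<And>t. t \<in> I \<Longrightarrow> norm (dds x t) = 1"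
    and star: "\<And>t. t \<in> I \<Longrightarrow> dds (dds x) t
      = (2 / u t) *\<^sub>R (dds x t \<times> (grad V (x t) \<times> dds x t)) + l t *\<^sub>R (dds x t \<times> grad V (x t))"
    and W: "grad V differentiable (at (x s))"
    and n: "dds x s \<times> grad V (x s) \<noteq> 0" and u: "u s \<noteq> 0"
    and u': "(u has_real_derivative u') (at s)" and l': "(l has_real_derivative l') (at s)"
  shows "(dds (dds x) has_vector_derivative third_order_rhs V c x s
      - (2 / (u s)\<^sup>2 * (u' - dds x s \<bullet> grad V (x s) - c * (u s)\<^sup>2)) *\<^sub>R
          (dds x s \<times> (grad V (x s) \<times> dds x s))
      + l' *\<^sub>R (dds x s \<times> grad V (x s))) (at s)"
proof -
  define v w where "v = dds x" and "w = (\<lambda>t. grad V (x t))"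
  define a D Q where "a = dds v s" and "D = dds w s" and "Q = dds (\<lambda>t. v t \<times> w t) s"
  have dv: "(v has_vector_derivative a) (at s)"
    using x2[OF I(2)] has_vector_derivative_dds by (simp add: v_def a_def)
  have dw: "(w has_vector_derivative D) (at s)"
    unfolding D_def
    by (rule has_vector_derivative_dds)
      (simp add: w_def differentiable_along_curve W x1[OF I(2)])
  have dn: "((\<lambda>t. v t \<times> w t) has_vector_derivative Q) (at s)"
    unfolding Q_def
    using has_vector_derivative_cross3[OF dv dw]
    by (intro has_vector_derivative_dds differentiableI_vector)
  \<comment> \<open>This form of the double cross product reduces its derivative to the product rule
    for one inner product.\<close>
  have P: "v t \<times> (w t \<times> v t) = w t - (v t \<bullet> w t) *\<^sub>R v t" if "t \<in> I" for t
    using unit[OF that] by (simp add: Lagrange v_def norm_eq_1)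
  have dvw: "((\<lambda>t. v t \<bullet> w t) has_real_derivative v s \<bullet> D + a \<bullet> w s) (at s)"
    using bounded_bilinear.has_vector_derivative[OF bounded_bilinear_inner dv dw]
    by (simp add: has_real_derivative_iff_has_vector_derivative)
  have dP: "((\<lambda>t. w t - (v t \<bullet> w t) *\<^sub>R v t) has_vector_derivative
      D - (a \<bullet> w s + v s \<bullet> D) *\<^sub>R v s - (v s \<bullet> w s) *\<^sub>R a) (at s)"
    using has_vector_derivative_diff[OF dw has_vector_derivative_scaleR[OF dvw dv]]
    by (simp add: algebra_simps)
  have "((\<lambda>t. 2 / u t) has_real_derivative - (2 * u' / (u s)\<^sup>2)) (at s)"
    using u by (auto intro!: derivative_eq_intros u' simp: power2_eq_square)
  then have "((\<lambda>t. (2 / u t) *\<^sub>R (w t - (v t \<bullet> w t) *\<^sub>R v t) + l t *\<^sub>R (v t \<times> w t))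
    has_vector_derivative
      (2 / u s) *\<^sub>R (D - (a \<bullet> w s + v s \<bullet> D) *\<^sub>R v s - (v s \<bullet> w s) *\<^sub>R a)
      - (2 * u' / (u s)\<^sup>2) *\<^sub>R (v s \<times> (w s \<times> v s))
      + (l s *\<^sub>R Q + l' *\<^sub>R (v s \<times> w s))) (at s)"
    using has_vector_derivative_add[OF has_vector_derivative_scaleR[OF _ dP]
        has_vector_derivative_scaleR[OF l' dn]] P[OF I(2)]
    by fastforce
  \<comment> \<open>The second-order equation holds throughout the open set \<open>I\<close>, so it
    may be differentiated.\<close>
  then have "(dds (dds x) has_vector_derivative
      (2 / u s) *\<^sub>R (D - (a \<bullet> w s + v s \<bullet> D) *\<^sub>R v s - (v s \<bullet> w s) *\<^sub>R a)
      - (2 * u' / (u s)\<^sup>2) *\<^sub>R (v s \<times> (w s \<times> v s))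
      + (l s *\<^sub>R Q + l' *\<^sub>R (v s \<times> w s))) (at s)"
    by (rule has_vector_derivative_transform_within_open[OF _ I])
      (use star P in \<open>simp add: v_def w_def\<close>)
  moreover have "norm (v s) = 1" "v s \<times> w s \<noteq> 0"
      "a = (2 / u s) *\<^sub>R (v s \<times> (w s \<times> v s)) + l s *\<^sub>R (v s \<times> w s)"
    using unit[OF I(2)] n star[OF I(2)] by (simp_all add: a_def v_def w_def)
  note third_order_identity[OF this(1,2) u this(3), of D u' Q c]
  ultimately show ?thesis
    unfolding third_order_rhs_def Let_def
    by (simp add: add.assoc[symmetric] v_def w_def a_def D_def Q_def)
qed

text \<open>Both corrections vanish, since \<open>u\<close> follows the null evolution and
  \<open>l\<close> is constant. Pairing the second-order equation with \<open>\<nabla>V\<close>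
  gives \<open>2 N / u\<close>, which is nonzero; pairing it with
  \<open>x' \<times> \<nabla>V\<close> gives \<open>l N\<close>, so \<open>l\<close> can be
  recovered from the projection.\<close>

lemma star_projection:
  assumes I: "open I" and V: "C2_on V U"
    and \<gamma>: "kt_null_curve V c U I \<gamma>" "transverse_on V I (retraction_projection \<gamma>)"
    and star: "satisfies_star V c l I \<gamma>"
  defines "x \<equiv> retraction_projection \<gamma>"
  shows "third_order_integral_curve V c U I x" "finite_time_on V I x"
    and "\<And>s. s \<in> I \<Longrightarrow> dds (dds x) s \<bullet> (dds x s \<times> grad V (x s))
      = l * (norm (dds x s \<times> grad V (x s)))\<^sup>2"
proof -
  have Vd: "V differentiable (at p)" if "p \<in> U" for p
    using V that by (simp add: C2_on_def)
  note null = kt_null_curveD[OF \<gamma>(1), folded x_def]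
  have xd: "x differentiable (at s)" "dds x differentiable (at s)"
    and eq: "dds (dds x) s = (2 / kt_factor V c (\<gamma> s)) *\<^sub>R (dds x s \<times> (grad V (x s) \<times> dds x s))
        + l *\<^sub>R (dds x s \<times> grad V (x s))" if "s \<in> I" for s
    using star that by (simp_all add: satisfies_star_def Let_def x_def)
  have n: "dds x s \<times> grad V (x s) \<noteq> 0" if "s \<in> I" for s
    using \<gamma>(2) that by (simp add: transverse_on_def x_def)
  have x3: "(dds (dds x) has_vector_derivative third_order_rhs V c x s) (at s)" if "s \<in> I" for s
    using star_third_derivative[OF I that xd null(4) eq C2_on_grad_differentiable[OF V null(1)[OF that]]
        n[OF that] null(2)[OF that] kt_factor_along_null_curve[OF \<gamma>(1) that Vd, folded x_def]
        DERIV_const, of c]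
    by simp
  then show "third_order_integral_curve V c U I x"
    using \<gamma>(2) null(1,4) xd dds_eq[OF x3] differentiableI_vector[OF x3]
    by (simp add: third_order_integral_curve_def x_def)
  show "finite_time_on V I x"
    unfolding finite_time_on_def
    using n null(2) triple_cross_unit(1)[OF null(4)]
    by (simp add: eq inner_add_left dot_cross_self)
  show "dds (dds x) s \<bullet> (dds x s \<times> grad V (x s)) = l * (norm (dds x s \<times> grad V (x s)))\<^sup>2"
    if "s \<in> I" for s
    using triple_cross_unit(3)[OF null(4)[OF that], of "grad V (x s)"]
    by (simp add: eq[OF that] inner_add_left power2_norm_eq_inner)
qed

text \<open>The functions \<open>u\<close> and \<open>l\<close> are read off from \<open>x''\<close>
  by the same two pairings. The third-order system then supplies the evolution of \<open>u\<close>
  and the constancy of \<open>l\<close>, and \<open>c \<noteq> 0\<close> allows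
  \<open>V + c T = u\<close> to be solved for \<open>T\<close>.\<close>

lemma integral_curve_lift:
  assumes I: "open I" "is_interval I" and V: "C2_on V U" and c: "c \<noteq> 0"
    and x: "third_order_integral_curve V c U I x" "finite_time_on V I x"
  obtains \<gamma> l where "kt_null_curve V c U I \<gamma>" "satisfies_star V c l I \<gamma>"
    "retraction_projection \<gamma> = x"
proof -
  define v w where "v = dds x" and "w = (\<lambda>t. grad V (x t))"
  define N where "N = (\<lambda>t. (v t \<times> w t) \<bullet> (v t \<times> w t))"
  define u where "u = (\<lambda>t. 2 * N t / (dds v t \<bullet> w t))"
  define l where "l = (\<lambda>t. (dds v t \<bullet> (v t \<times> w t)) / N t)"
  have xU: "x s \<in> U" and xd: "x differentiable (at s)" "v differentiable (at s)"
      "dds v differentiable (at s)" and unit: "norm (v s) = 1"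
    and rhs: "dds (dds v) s = third_order_rhs V c x s"
    and n: "v s \<times> w s \<noteq> 0" and fin: "dds v s \<bullet> w s \<noteq> 0" if "s \<in> I" for s
    using x that
    by (simp_all add: third_order_integral_curve_def transverse_on_def finite_time_on_def v_def w_def)
  have N: "N s \<noteq> 0" "N s = (norm (v s \<times> w s))\<^sup>2" if "s \<in> I" for s
    using n[OF that] by (simp_all add: N_def power2_norm_eq_inner)
  have u0: "u s \<noteq> 0" if "s \<in> I" for s
    using N fin that by (simp add: u_def)
  have Vd: "V differentiable (at (x s))" "grad V differentiable (at (x s))" if "s \<in> I" for s
    using V xU[OF that] C2_on_grad_differentiable by (auto simp: C2_on_def)
  have wd: "w differentiable (at s)" if "s \<in> I" for s
    unfolding w_def using Vd xd that by (simp add: differentiable_along_curve)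
  have nd: "(\<lambda>t. v t \<times> w t) differentiable (at s)" if "s \<in> I" for s
    using xd(2)[OF that, THEN has_vector_derivative_dds] wd[OF that, THEN has_vector_derivative_dds]
    by (rule differentiableI_vector[OF has_vector_derivative_cross3])
  have Nd: "N differentiable (at s)" if "s \<in> I" for s
    unfolding N_def using nd that by (intro differentiable_inner)
  have "u differentiable (at s)" "l differentiable (at s)" if "s \<in> I" for s
    unfolding u_def l_def using Nd nd wd xd N fin that
    by (intro differentiable_divide differentiable_mult differentiable_inner differentiable_const; simp)+
  then obtain u' l' where u': "\<And>s. s \<in> I \<Longrightarrow> (u has_real_derivative u' s) (at s)"
    and l': "\<And>s. s \<in> I \<Longrightarrow> (l has_real_derivative l' s) (at s)"
    by (metis real_differentiable_def)
  have star: "dds v s = (2 / u s) *\<^sub>R (v s \<times> (w s \<times> v s)) + l s *\<^sub>R (v s \<times> w s)"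
    if "s \<in> I" for s
  proof -
    have "v s \<bullet> dds v s = 0"
      by (rule unit_speed_orthogonal[OF I(1) that unit])
        (simp_all add: xd(2)[OF that] has_vector_derivative_dds)
    from orthogonal_to_unit_decomposition[OF unit[OF that] this n[OF that]]
    show ?thesis using N[OF that] fin[OF that] by (simp add: u_def l_def)
  qed
  have evolution: "u' s = v s \<bullet> w s + c * (u s)\<^sup>2" "l' s = 0" if "s \<in> I" for s
  proof -
    define e where "e = 2 / (u s)\<^sup>2 * (u' s - v s \<bullet> w s - c * (u s)\<^sup>2)"
    have "(dds v has_vector_derivative third_order_rhs V c x s
        - e *\<^sub>R (v s \<times> (w s \<times> v s)) + l' s *\<^sub>R (v s \<times> w s)) (at s)"
      using star_third_derivative[OF I(1) that xd(1) _ _ _ Vd(2)[OF that] _ u0[OF that] u'[OF that]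
          l'[OF that], of c] xd(2) unit star n[OF that]
      unfolding v_def w_def e_def by blast
    \<comment> \<open>Two expressions for \<open>x'''\<close> are compared. Pairing the difference
      with \<open>\<nabla>V\<close> isolates \<open>e\<close>, and pairing it with
      \<open>x' \<times> \<nabla>V\<close> isolates \<open>l'\<close>.\<close>
    from dds_eq[OF this] have 0: "l' s *\<^sub>R (v s \<times> w s) - e *\<^sub>R (v s \<times> (w s \<times> v s)) = 0"
      by (simp add: rhs[OF that])
    note P = triple_cross_unit[OF unit[OF that], of "w s"]
    have "e * N s = 0"
      using arg_cong[OF 0, of "\<lambda>z. z \<bullet> w s"] P(1) N(2)[OF that]
      by (simp add: inner_diff_left dot_cross_self)
    then show "u' s = v s \<bullet> w s + c * (u s)\<^sup>2"
      using N[OF that] u0[OF that] by (simp add: e_def)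
    have "l' s * N s = 0"
      using arg_cong[OF 0, of "\<lambda>z. z \<bullet> (v s \<times> w s)"] P(3)
      by (simp add: inner_diff_left N_def)
    then show "l' s = 0" using N[OF that] by simp
  qed
  \<comment> \<open>A vanishing derivative gives a single constant because \<open>I\<close> is an
    interval.\<close>
  have "\<exists>k. \<forall>s\<in>I. l s = k"
    by (rule has_field_derivative_zero_constant[of I])
      (use I(2) l' evolution(2) in \<open>auto simp: is_interval_convex intro: has_field_derivative_at_within\<close>)
  then obtain k where k: "\<And>s. s \<in> I \<Longrightarrow> l s = k" by blast
  \<comment> \<open>The spatial part is \<open>x\<close> at every parameter, also outside
    \<open>I\<close>, so that the projection equals \<open>x\<close> as a function.\<close>
  define \<gamma> :: "real \<Rightarrow> event"
    where "\<gamma> = (\<lambda>t. \<chi> \<mu>. case \<mu> of None \<Rightarrow> (u t - V (x t)) / c | Some i \<Rightarrow> x t $ i)"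
  have space: "space_part (\<gamma> t) = x t" and time: "time_part (\<gamma> t) = (u t - V (x t)) / c" for t
    by (simp_all add: \<gamma>_def space_part_def time_part_def vec_eq_iff)
  have proj: "retraction_projection \<gamma> = x"
    by (simp add: retraction_projection_def space)
  have factor: "kt_factor V c (\<gamma> t) = u t" for t
    using c by (simp add: kt_factor_def space time)
  have d\<gamma>: "(\<gamma> has_vector_derivative
      (\<chi> \<mu>. case \<mu> of None \<Rightarrow> (u s)\<^sup>2 | Some i \<Rightarrow> v s $ i)) (at s)" if "s \<in> I" for s
    unfolding has_vector_derivative_vec_nth_iff
  proof
    fix \<mu> :: "3 option"
    have dx: "(x has_vector_derivative v s) (at s)"
      using xd(1)[OF that] by (simp add: v_def has_vector_derivative_dds)
    have "((\<lambda>t. (u t - V (x t)) / c) has_real_derivative (u' s - v s \<bullet> w s) / c) (at s)"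
      using DERIV_cdivide[OF DERIV_diff[OF u'[OF that]
            has_real_derivative_along_curve[of V x s, OF Vd(1)[OF that] dx]]]
      by (simp add: w_def)
    \<comment> \<open>The evolution law of \<open>u\<close> is exactly what makes
      \<open>dT/ds = u^2\<close>.\<close>
    then have "((\<lambda>t. (u t - V (x t)) / c) has_real_derivative (u s)\<^sup>2) (at s)"
      using c by (simp add: evolution(1)[OF that])
    then show "((\<lambda>t. \<gamma> t $ \<mu>) has_real_derivative
        (\<chi> \<mu>. case \<mu> of None \<Rightarrow> (u s)\<^sup>2 | Some i \<Rightarrow> v s $ i) $ \<mu>) (at s)"
      using dx by (cases \<mu>) (simp_all add: \<gamma>_def has_vector_derivative_vec_nth_iff)
  qed
  have "kt_null_curve V c U I \<gamma>"
    unfolding kt_null_curve_def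
  proof
    fix s assume s: "s \<in> I"
    have "space_part (dds \<gamma> s) = v s" "time_part (dds \<gamma> s) = (u s)\<^sup>2"
      by (simp_all add: dds_eq[OF d\<gamma>[OF s]] space_part_def time_part_def vec_eq_iff)
    then show "space_part (\<gamma> s) \<in> U \<and> kt_factor V c (\<gamma> s) \<noteq> 0 \<and> \<gamma> differentiable (at s) \<and>
        norm (dds (retraction_projection \<gamma>) s) = 1 \<and>
        dds \<gamma> s \<bullet> (kt_metric V c (\<gamma> s) *v dds \<gamma> s) = 0 \<and> time_part (dds \<gamma> s) > 0"
      using xU[OF s] u0[OF s] unit[OF s] kt_null_vector_iff[of V c "\<gamma> s" "dds \<gamma> s"]
        differentiableI_vector[OF d\<gamma>[OF s]]
      by (simp add: space factor proj v_def[symmetric])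
  qed
  moreover have "satisfies_star V c k I \<gamma>"
    using xd star k by (simp add: satisfies_star_def proj factor v_def w_def)
  ultimately show thesis using that proj by blast
qed

section \<open>The two equalities between sets of curves\<close>

theorem proposition5p1:
  fixes V :: "real^3 \<Rightarrow> real" and c :: real and U :: "(real^3) set" and I :: "real set"
  assumes "open U" and "harmonic_on V U"
    and "c \<noteq> 0"
    and "open I" and "is_interval I"
  shows "retraction_projection `
           {\<gamma>. kt_null_curve V c U I \<gamma> \<and> transverse_on V I (retraction_projection \<gamma>) \<and>
                (\<exists>l. satisfies_star V c l I \<gamma>)}
         = {x. third_order_integral_curve V c U I x \<and> finite_time_on V I x}
       \<and> retraction_projection `
           {\<gamma>. kt_null_curve V c U I \<gamma> \<and> transverse_on V I (retraction_projection \<gamma>) \<and>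
                geodesic_on (kt_metric V c) I \<gamma>}
         = {x. third_order_integral_curve V c U I x \<and> finite_time_on V I x \<and>
                (\<forall>s\<in>I. dds (dds x) s \<bullet> cross3 (dds x s) (grad V (x s)) = 0)}"
proof -
  have V: "C2_on V U" using assms(2) by (simp add: harmonic_on_def)
  then have "V differentiable (at p)" if "p \<in> U" for p
    using that by (simp add: C2_on_def)
  note geodesic = kt_null_geodesic_iff_star[OF \<open>open I\<close> this]
  note proj = star_projection[OF \<open>open I\<close> V]
  have lift: "\<exists>\<gamma> l. kt_null_curve V c U I \<gamma> \<and> transverse_on V I (retraction_projection \<gamma>) \<and>
      satisfies_star V c l I \<gamma> \<and> retraction_projection \<gamma> = x"
    if "third_order_integral_curve V c U I x" "finite_time_on V I x" for x
    using integral_curve_lift[OF \<open>open I\<close> \<open>is_interval I\<close> V \<open>c \<noteq> 0\<close> that] that(1)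
    by (metis third_order_integral_curve_def)
  have l0: "satisfies_star V c 0 I \<gamma>"
    if "kt_null_curve V c U I \<gamma>" "transverse_on V I (retraction_projection \<gamma>)"
      "satisfies_star V c l I \<gamma>" and x: "retraction_projection \<gamma> = x"
      "\<forall>s\<in>I. dds (dds x) s \<bullet> (dds x s \<times> grad V (x s)) = 0" for \<gamma> l x
  \<comment> \<open>At any point of \<open>I\<close> the triple product equals \<open>l N\<close>
    with \<open>N\<close> nonzero, which forces \<open>l = 0\<close>. On empty \<open>I\<close> the
    value of \<open>l\<close> is undetermined, but the equation with 0 holds vacuously.\<close>
  proof (cases "I = {}")
    case False
    then obtain s where s: "s \<in> I" by blast
    then have "l = 0"
      using proj(3)[OF that(1-3) s] x that(2) by (simp add: transverse_on_def)
    then show ?thesis using that(3) by simp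
  qed (simp add: satisfies_star_def)
  show ?thesis
  proof (intro conjI set_eqI iffI)
    fix x assume "x \<in> retraction_projection ` {\<gamma>. kt_null_curve V c U I \<gamma> \<and>
        transverse_on V I (retraction_projection \<gamma>) \<and> (\<exists>l. satisfies_star V c l I \<gamma>)}"
    then show "x \<in> {x. third_order_integral_curve V c U I x \<and> finite_time_on V I x}"
      using proj(1,2) by blast
  next
    fix x assume "x \<in> {x. third_order_integral_curve V c U I x \<and> finite_time_on V I x}"
    then show "x \<in> retraction_projection ` {\<gamma>. kt_null_curve V c U I \<gamma> \<and>
        transverse_on V I (retraction_projection \<gamma>) \<and> (\<exists>l. satisfies_star V c l I \<gamma>)}"
      using lift by blast
  next
    fix x assume "x \<in> retraction_projection ` {\<gamma>. kt_null_curve V c U I \<gamma> \<and>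
        transverse_on V I (retraction_projection \<gamma>) \<and> geodesic_on (kt_metric V c) I \<gamma>}"
    then show "x \<in> {x. third_order_integral_curve V c U I x \<and> finite_time_on V I x \<and>
        (\<forall>s\<in>I. dds (dds x) s \<bullet> (dds x s \<times> grad V (x s)) = 0)}"
      \<comment> \<open>A null geodesic satisfies the second-order equation with
        \<open>l = 0\<close>, so the triple product \<open>l N\<close> vanishes.\<close>
      using proj[where l = 0] geodesic by auto
  next
    fix x assume "x \<in> {x. third_order_integral_curve V c U I x \<and> finite_time_on V I x \<and>
        (\<forall>s\<in>I. dds (dds x) s \<bullet> (dds x s \<times> grad V (x s)) = 0)}"
    then show "x \<in> retraction_projection ` {\<gamma>. kt_null_curve V c U I \<gamma> \<and>
        transverse_on V I (retraction_projection \<gamma>) \<and> geodesic_on (kt_metric V c) I \<gamma>}"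
      using lift[of x] l0[of _ _ x] geodesic by blast
  qed
qed

end
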